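(* For any probability $p=p(n)\in[0,1]$, with high probability (i.e. with probability tending to $1$ as $n\to\infty$) the Erdős–Rényi random graph $G(n,p)$ has a separating path system of size at most $48n$.
   Context: $G(n,p)$ is the random graph on $n$ vertices in which each pair of vertices is joined by an edge independently with probability $p$. For a graph $G$, a family $\mathcal{P}$ of subsets of $E(G)$ is a separating path system of $G$ if every member of $\mathcal{P}$ is (the edge set of) a path in $G$, and for every pair of distinct edges $e,e'\in E(G)$ there is some $P\in\mathcal{P}$ containing exactly one of $e,e'$. *)

theory Defs
  imports "HOL-Probability.Probability"
begin

definition all_pairs :: "nat \<Rightarrow> nat set set" where
  "all_pairs n = {e. e \<subseteq> {..<n} \<and> card e = 2}"

definition Gnp :: "nat \<Rightarrow> real \<Rightarrow> nat set set pmf" where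
  "Gnp n p = map_pmf (\<lambda>f. {e \<in> all_pairs n. f e})
      (Pi_pmf (all_pairs n) False (\<lambda>_. bernoulli_pmf p))"

definition is_path_in :: "nat set set \<Rightarrow> nat set set \<Rightarrow> bool" where
  "is_path_in E P \<longleftrightarrow> (\<exists>vs. vs \<noteq> [] \<and> distinct vs \<and>
      (\<forall>i. Suc i < length vs \<longrightarrow> {vs ! i, vs ! Suc i} \<in> E) \<and>
      P = {{vs ! i, vs ! Suc i} | i. Suc i < length vs})"

definition separating_path_system :: "nat set set \<Rightarrow> nat set set set \<Rightarrow> bool" where
  "separating_path_system E \<P> \<longleftrightarrow>
     (\<forall>P\<in>\<P>. is_path_in E P) \<and>
     (\<forall>e\<in>E. \<forall>e'\<in>E. e \<noteq> e' \<longrightarrow> (\<exists>P\<in>\<P>. (e \<in> P) \<noteq> (e' \<in> P)))"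

end

theory Submission
  imports Defs
begin

text \<open>
  The bound holds for every graph, with constant 17 in place of 48. Let \<open>P\<close> be a longest path and
  let \<open>S\<close> be the set of end vertices of the paths obtained from \<open>P\<close> by Posa rotations. All edges
  meeting \<open>S\<close> lie inside the set \<open>T\<close> consisting of \<open>S\<close> and its neighbours along \<open>P\<close>, and
  \<open>|T| \<le> 3|S|\<close>. Number the vertices of \<open>T\<close> along \<open>P\<close>. For \<open>c \<in> {1, 2}\<close> and fixed \<open>k\<close> the edges
  \<open>ij\<close> with \<open>i < j\<close> and \<open>i + c j = k\<close> are nested chords of \<open>P\<close>, so a zigzag along \<open>P\<close> passes through
  all of them, and the two values of \<open>k\<close> determine \<open>i\<close> and \<open>j\<close>. This gives at most \<open>15|S|\<close> paths; the
  at most \<open>2|S|\<close> edges of \<open>P\<close> that meet \<open>S\<close> are added as paths of length one. Then recurse on the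
  graph without \<open>S\<close>; keeping the system covering separates the edges meeting \<open>S\<close> from the others.
\<close>

section \<open>Edge sets of vertex lists\<close>

text \<open>A recursive version of the edge set in \<open>is_path_in\<close>, so that concatenation,
  reversal and relabelling of paths can be handled by induction on lists.\<close>

fun path_edges :: "'a list \<Rightarrow> 'a set set" where
  "path_edges (x # y # zs) = insert {x, y} (path_edges (y # zs))"
| "path_edges _ = {}"

lemma path_edges_conv_nth: "path_edges vs = {{vs ! i, vs ! Suc i} | i. Suc i < length vs}"
proof (induction vs rule: path_edges.induct)
  case (1 x y zs)
  have "{{(x # y # zs) ! i, (x # y # zs) ! Suc i} | i. Suc i < length (x # y # zs)}
      = insert {x, y} {{(y # zs) ! i, (y # zs) ! Suc i} | i. Suc i < length (y # zs)}" (is "?L = ?R")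
  proof
    show "?L \<subseteq> ?R"
    proof
      fix e assume "e \<in> ?L"
      then obtain i where "Suc i < length (x # y # zs)" "e = {(x # y # zs) ! i, (x # y # zs) ! Suc i}"
        by blast
      then show "e \<in> ?R" by (cases i) auto
    qed
    show "?R \<subseteq> ?L"
    proof
      fix e assume "e \<in> ?R"
      then consider "e = {x, y}"
        | i where "Suc i < length (y # zs)" "e = {(y # zs) ! i, (y # zs) ! Suc i}"
        by blast
      then show "e \<in> ?L"
      proof cases
        case 1
        then show ?thesis by (auto intro!: exI[of _ 0])
      next
        case (2 i)
        then show ?thesis by (auto intro!: exI[of _ "Suc i"])
      qed
    qed
  qed
  then show ?case using 1 by simp
qed auto

lemma is_path_in_path_edges:
  assumes "vs \<noteq> []" "distinct vs" "path_edges vs \<subseteq> E"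
  shows "is_path_in E (path_edges vs)"
  using assms unfolding is_path_in_def path_edges_conv_nth by blast

lemma path_edges_append:
  "xs \<noteq> [] \<Longrightarrow> ys \<noteq> [] \<Longrightarrow>
    path_edges (xs @ ys) = path_edges xs \<union> insert {last xs, hd ys} (path_edges ys)"
proof (induction xs rule: path_edges.induct)
  case ("2_2" v)
  then show ?case by (cases ys) auto
qed auto

lemma path_edges_rev: "path_edges (rev xs) = path_edges xs"
proof (induction xs rule: path_edges.induct)
  case (1 x y zs)
  have "path_edges (rev (x # y # zs)) = path_edges (rev (y # zs) @ [x])" by simp
  also have "\<dots> = path_edges (y # zs) \<union> {{y, x}}"
    using 1 by (subst path_edges_append) auto
  finally show ?case by (simp add: insert_commute)
qed auto

lemma path_edges_map: "path_edges (map f xs) = image f ` path_edges xs"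
  by (induction xs rule: path_edges.induct) auto

lemma path_edges_subset_set: "e \<in> path_edges xs \<Longrightarrow> e \<subseteq> set xs"
  by (induction xs rule: path_edges.induct) auto

lemma path_edges_upt: "path_edges [i..<j] \<subseteq> {{k, Suc k} | k. i \<le> k \<and> Suc k < j}"
proof
  fix e assume "e \<in> path_edges [i..<j]"
  then obtain l where "Suc l < j - i" "e = {i + l, Suc (i + l)}"
    unfolding path_edges_conv_nth by auto
  then show "e \<in> {{k, Suc k} | k. i \<le> k \<and> Suc k < j}"
    by (intro CollectI exI[of _ "i + l"]) auto
qed

lemma finite_path_edges: "finite (path_edges xs)"
  by (induction xs rule: path_edges.induct) auto

lemma card_path_edges_incident:
  assumes "distinct vs"
  shows "card {e \<in> path_edges vs. v \<in> e} \<le> 2"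
proof (cases "v \<in> set vs")
  case True
  then obtain i where i: "i < length vs" "v = vs ! i" by (auto simp: in_set_conv_nth)
  \<comment> \<open>Only positions \<open>i - 1\<close> and \<open>i\<close> can carry an edge at
    \<open>vs ! i\<close>. At either end of the list one of the two listed sets is spurious (for
    \<open>i = 0\<close> the first collapses to a singleton), which is harmless for an upper
    bound.\<close>
  have "{e \<in> path_edges vs. v \<in> e} \<subseteq> {{vs ! (i - 1), vs ! i}, {vs ! i, vs ! Suc i}}"
  proof
    fix e assume "e \<in> {e \<in> path_edges vs. v \<in> e}"
    then obtain j where j: "Suc j < length vs" "e = {vs ! j, vs ! Suc j}" "vs ! i \<in> e"
      unfolding path_edges_conv_nth using i by auto
    then have "i = j \<or> i = Suc j" using assms i by (auto simp: nth_eq_iff_index_eq)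
    then show "e \<in> {{vs ! (i - 1), vs ! i}, {vs ! i, vs ! Suc i}}" using j by auto
  qed
  then have "card {e \<in> path_edges vs. v \<in> e} \<le> card {{vs ! (i - 1), vs ! i}, {vs ! i, vs ! Suc i}}"
    by (intro card_mono) auto
  also have "\<dots> \<le> 2" by (simp add: card_insert_if)
  finally show ?thesis .
next
  case False
  then have "{e \<in> path_edges vs. v \<in> e} = {}" using path_edges_subset_set by fastforce
  then show ?thesis by (metis card.empty zero_le)
qed

lemma card_path_neighbours:
  assumes "distinct vs"
  shows "card {w. {v, w} \<in> path_edges vs} \<le> 2"
proof -
  have "inj_on (\<lambda>w. {v, w}) {w. {v, w} \<in> path_edges vs}"
    by (auto simp: inj_on_def doubleton_eq_iff)
  moreover have "finite {e \<in> path_edges vs. v \<in> e}" by (simp add: finite_path_edges)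
  ultimately have "card {w. {v, w} \<in> path_edges vs} \<le> card {e \<in> path_edges vs. v \<in> e}"
    by (intro card_inj_on_le[of "\<lambda>w. {v, w}"]) auto
  then show ?thesis using card_path_edges_incident[OF assms, of v] by simp
qed

section \<open>Posa rotations\<close>

text \<open>The first vertex stays fixed. The chord from the last vertex to \<open>w\<close>
  replaces the edge from \<open>w\<close> to \<open>hd ys\<close>, and \<open>hd ys\<close> becomes
  the new last vertex.\<close>

inductive_set rotations :: "'a set set \<Rightarrow> 'a list \<Rightarrow> 'a list set" for E vs where
  base: "vs \<in> rotations E vs"
| rotate: "xs @ w # ys \<in> rotations E vs \<Longrightarrow> ys \<noteq> [] \<Longrightarrow> {w, last ys} \<in> E
    \<Longrightarrow> xs @ w # rev ys \<in> rotations E vs"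

lemma path_edges_rotate:
  assumes "ys \<noteq> []"
  shows "path_edges (xs @ w # rev ys) \<subseteq> insert {w, last ys} (path_edges (xs @ w # ys))"
proof -
  have *: "path_edges (w # zs) = insert {w, hd zs} (path_edges zs)" if "zs \<noteq> []" for zs
    using that by (cases zs) auto
  show ?thesis using assms
    by (cases "xs = []") (auto simp: * path_edges_append path_edges_rev hd_rev)
qed

lemma rotations_path:
  assumes "us \<in> rotations E vs" "distinct vs" "path_edges vs \<subseteq> E" "vs \<noteq> []"
  shows "distinct us \<and> set us = set vs \<and> us \<noteq> [] \<and> path_edges us \<subseteq> E"
  using assms
proof (induction rule: rotations.induct)
  case (rotate xs w ys)
  then show ?case using path_edges_rotate[of ys xs w] by auto
qed auto

text \<open>Rotations create edges only inside \<open>T\<close>. A new edge joins an old end, which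
  is in \<open>S\<close>, to \<open>w\<close>. Before the rotation \<open>w\<close> was adjacent to
  the new end \<open>z\<close>, also in \<open>S\<close>; by induction that edge belongs to
  \<open>vs\<close>, making \<open>w\<close> a neighbour of \<open>S\<close> along
  \<open>vs\<close>, or it lies inside \<open>T\<close> already.\<close>

lemma rotations_path_edges:
  fixes E vs
  defines "S \<equiv> last ` rotations E vs"
  defines "T \<equiv> S \<union> (\<Union>s\<in>S. {w. {s, w} \<in> path_edges vs})"
  assumes "us \<in> rotations E vs"
  shows "path_edges us \<subseteq> path_edges vs \<union> Pow T"
  using assms(3)
proof (induction rule: rotations.induct)
  case (rotate xs w ys)
  obtain z zs where ys: "ys = z # zs" using rotate.hyps by (cases ys) auto
  have "xs @ w # rev ys \<in> rotations E vs" by (intro rotations.rotate rotate.hyps)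
  then have z: "z \<in> S" unfolding S_def ys by force
  have "last (xs @ w # ys) \<in> S" unfolding S_def using rotate.hyps by (intro imageI)
  then have "last ys \<in> S" using rotate.hyps by simp
  moreover have "w \<in> T"
  proof -
    have "{w, z} \<in> path_edges (xs @ w # ys)"
      unfolding ys by (cases "xs = []") (auto simp: path_edges_append)
    then have "{z, w} \<in> path_edges vs \<union> Pow T" using rotate.IH by (auto simp: insert_commute)
    then show ?thesis using z unfolding T_def by blast
  qed
  ultimately have "{w, last ys} \<in> Pow T" unfolding T_def by blast
  then show ?case using path_edges_rotate[of ys xs w] rotate by blast
qed auto

text \<open>If \<open>s\<close> is the end of a rotated path and \<open>w\<close> a neighbour of
  \<open>s\<close>, rotating at \<open>w\<close> turns the successor of \<open>w\<close> into an
  end. The edge from \<open>w\<close> to that successor is in \<open>vs\<close> or inside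
  \<open>T\<close>, so \<open>w\<close> is in \<open>T\<close> either way. The factor 3 counts each
  end together with its at most two neighbours on \<open>vs\<close>.\<close>

lemma posa_rotation:
  fixes E :: "'a set set"
  assumes vs: "distinct vs" "vs \<noteq> []" "path_edges vs \<subseteq> E"
    and longest: "\<And>us. distinct us \<Longrightarrow> path_edges us \<subseteq> E \<Longrightarrow> length us \<le> length vs"
  obtains S T where "S \<noteq> {}" "S \<subseteq> T" "T \<subseteq> set vs" "card T \<le> 3 * card S"
    "\<And>s w. s \<in> S \<Longrightarrow> {s, w} \<in> E \<Longrightarrow> w \<in> T"
proof -
  define S where "S = last ` rotations E vs"
  define T where "T = S \<union> (\<Union>s\<in>S. {w. {s, w} \<in> path_edges vs})"
  have S: "S \<subseteq> set vs"
    unfolding S_def using rotations_path[OF _ vs(1,3,2)] last_in_set by blast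
  then have finS: "finite S" using finite_subset by blast
  have T: "T \<subseteq> set vs" unfolding T_def using S path_edges_subset_set by fastforce
  have "card T \<le> card S + card (\<Union>s\<in>S. {w. {s, w} \<in> path_edges vs})"
    unfolding T_def by (rule card_Un_le)
  also have "\<dots> \<le> card S + (\<Sum>s\<in>S. card {w. {s, w} \<in> path_edges vs})"
    using card_UN_le[OF finS] by simp
  also have "\<dots> \<le> card S + (\<Sum>s\<in>S. 2)"
    by (intro add_left_mono sum_mono card_path_neighbours vs)
  finally have cardT: "card T \<le> 3 * card S" by simp
  have "w \<in> T" if s: "s \<in> S" and e: "{s, w} \<in> E" for s w
  \<comment> \<open>\<open>E\<close> is an arbitrary set of sets here, so \<open>{s, w}\<close> may
    be a singleton.\<close>
  proof (cases "w = s")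
    case True
    then show ?thesis using s by (simp add: T_def)
  next
    case False
    obtain us where us: "us \<in> rotations E vs" "last us = s" using s S_def by blast
    note p = rotations_path[OF us(1) vs(1,3,2)]
    \<comment> \<open>Otherwise appending \<open>w\<close> to \<open>us\<close> would give a path
      longer than \<open>vs\<close>.\<close>
    have "w \<in> set us"
    proof (rule ccontr)
      assume w: "w \<notin> set us"
      have "length (us @ [w]) \<le> length vs"
        using p w us e by (intro longest) (auto simp: path_edges_append)
      moreover have "length us = length vs" using p vs distinct_card by metis
      ultimately show False by simp
    qed
    then obtain xs ys where xy: "us = xs @ w # ys" by (meson split_list)
    have "ys \<noteq> []" using xy us False by auto
    then obtain z zs where ys: "ys = z # zs" by (cases ys) auto
    have "last ys = s" using xy us ys by simp
    then have "xs @ w # rev ys \<in> rotations E vs"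
      using us e xy ys by (intro rotations.rotate) (auto simp: insert_commute)
    then have z: "z \<in> S" unfolding S_def ys by force
    have "{w, z} \<in> path_edges us"
      unfolding xy ys by (cases "xs = []") (auto simp: path_edges_append)
    then have "{z, w} \<in> path_edges vs \<union> Pow T"
      using rotations_path_edges[OF us(1)] unfolding T_def S_def by (auto simp: insert_commute)
    then show ?thesis using z unfolding T_def by blast
  qed
  moreover have "S \<noteq> {}" unfolding S_def using rotations.base by blast
  moreover have "S \<subseteq> T" by (simp add: T_def)
  ultimately show ?thesis using that T cardT by blast
qed

section \<open>Zigzag paths through nested chords\<close>

text \<open>A pair stands for a chord between two positions, the smaller first. Strictness at both
  ends makes distinct chords disjoint, as they must be for one path to traverse them alternately
  from left and right.\<close>

definition nested :: "(nat \<times> nat) set \<Rightarrow> bool" where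
  "nested M \<longleftrightarrow> (\<forall>(a, b)\<in>M. \<forall>(a', b')\<in>M. (a, b) = (a', b') \<or> a < a' \<and> b' < b \<or> a' < a \<and> b < b')"

text \<open>Both starting points are needed: after the outermost chord the zigzag continues in the
  inner interval from the opposite end.\<close>

lemma zigzag:
  assumes "finite M" "nested M" "\<forall>(a, b)\<in>M. lo \<le> a \<and> a < b \<and> b \<le> hi" "lo \<le> hi"
    "x = lo \<or> x = hi"
  shows "\<exists>q. q \<noteq> [] \<and> hd q = x \<and> distinct q \<and> set q \<subseteq> {lo..hi}
    \<and> (\<lambda>(a, b). {a, b}) ` M \<subseteq> path_edges q
    \<and> path_edges q \<subseteq> (\<lambda>(a, b). {a, b}) ` M \<union> {{i, Suc i} | i. lo \<le> i \<and> i < hi}"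
  using assms
proof (induction "card M" arbitrary: M lo hi x)
  case 0
  then have "M = {}" by simp
  then show ?case using 0 by (intro exI[of _ "[x]"]) auto
next
  case (Suc n)
  have ne: "M \<noteq> {}" using Suc.hyps(2) by auto
  \<comment> \<open>The chord with the least left end encloses all the others.\<close>
  define a where "a = Min (fst ` M)"
  have "a \<in> fst ` M" unfolding a_def using ne Suc.prems by (intro Min_in) auto
  then obtain b where ab: "(a, b) \<in> M" by auto
  have amin: "a \<le> a'" if "(a', b') \<in> M" for a' b'
    unfolding a_def using that Suc.prems by (intro Min_le) force+
  define M' where "M' = M - {(a, b)}"
  have M: "M = insert (a, b) M'" using ab by (auto simp: M'_def)
  have n: "n = card M'" using Suc.hyps(2) ab Suc.prems by (simp add: M'_def)
  have fin: "finite M'" and nest: "nested M'"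
    using Suc.prems by (auto simp: M'_def nested_def)
  have inner: "a < a' \<and> a' < b' \<and> b' < b" if "(a', b') \<in> M'" for a' b'
  proof -
    have m: "(a', b') \<in> M" "(a', b') \<noteq> (a, b)" using that by (auto simp: M'_def)
    then have "a < a' \<and> b' < b \<or> a' < a \<and> b < b'"
      using Suc.prems(2) ab unfolding nested_def by fastforce
    then show ?thesis using amin[OF m(1)] Suc.prems(3) m by auto
  qed
  have abl: "lo \<le> a" "a < b" "b \<le> hi" using Suc.prems(3) ab by auto
  have widen: "P \<union> insert y R \<subseteq> insert y A \<union> W"
    if "P \<subseteq> W" "R \<subseteq> A \<union> U" "U \<subseteq> W" for P R A U W and y :: "nat set"
    using that by blast
  from Suc.prems(5) show ?case
  proof
    \<comment> \<open>Walk up from \<open>lo\<close> to \<open>a\<close>, jump along the outer chord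
      to \<open>b\<close>, and continue from the right end of the interval from \<open>Suc a\<close>
      to \<open>b\<close>. The chord is exactly the edge joining the two concatenated lists.\<close>
    assume x: "x = lo"
    have "\<forall>(a', b')\<in>M'. Suc a \<le> a' \<and> a' < b' \<and> b' \<le> b" using inner by fastforce
    note IH = Suc.hyps(1)[OF n fin nest this, of b]
    obtain q where q: "q \<noteq> []" "hd q = b" "distinct q" "set q \<subseteq> {Suc a..b}"
      "(\<lambda>(a, b). {a, b}) ` M' \<subseteq> path_edges q"
      "path_edges q \<subseteq> (\<lambda>(a, b). {a, b}) ` M' \<union> {{i, Suc i} | i. Suc a \<le> i \<and> i < b}"
      using IH abl by auto
    have e: "path_edges ([lo..<Suc a] @ q) = path_edges [lo..<Suc a] \<union> insert {a, b} (path_edges q)"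
      using abl q by (subst path_edges_append) auto
    have u: "path_edges [lo..<Suc a] \<subseteq> {{i, Suc i} | i. lo \<le> i \<and> i < hi}"
      using path_edges_upt[of lo "Suc a"] abl by fastforce
    have u': "{{i, Suc i} | i. Suc a \<le> i \<and> i < b} \<subseteq> {{i, Suc i} | i. lo \<le> i \<and> i < hi}"
      using abl by fastforce
    show ?thesis
    proof (intro exI[of _ "[lo..<Suc a] @ q"] conjI)
      show "hd ([lo..<Suc a] @ q) = x" using abl x by (simp add: upt_conv_Cons del: upt_Suc)
      show "distinct ([lo..<Suc a] @ q)" using q by auto
      show "set ([lo..<Suc a] @ q) \<subseteq> {lo..hi}" using q(4) abl by auto
      show "(\<lambda>(a, b). {a, b}) ` M \<subseteq> path_edges ([lo..<Suc a] @ q)" unfolding e M using q(5) by auto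
      show "path_edges ([lo..<Suc a] @ q)
          \<subseteq> (\<lambda>(a, b). {a, b}) ` M \<union> {{i, Suc i} | i. lo \<le> i \<and> i < hi}"
        unfolding e M image_insert prod.case by (rule widen[OF u q(6) u'])
    qed (use q in auto)
  next
    \<comment> \<open>The mirror image: walk down from \<open>hi\<close> to \<open>b\<close>, jump
      to \<open>a\<close>, and continue from the left end of the interval from \<open>a\<close> to
      \<open>b - 1\<close>.\<close>
    assume x: "x = hi"
    \<comment> \<open>Since \<open>b\<close> is positive, \<open>b - 1\<close> is its true
      predecessor; for \<open>b = Suc a\<close> the inner interval is the single point
      \<open>a\<close>.\<close>
    have le: "a \<le> b - 1" using abl by simp
    have "\<forall>(a', b')\<in>M'. a \<le> a' \<and> a' < b' \<and> b' \<le> b - 1" using inner by fastforce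
    note IH = Suc.hyps(1)[OF n fin nest this, of a]
    obtain q where q: "q \<noteq> []" "hd q = a" "distinct q" "set q \<subseteq> {a..b - 1}"
      "(\<lambda>(a, b). {a, b}) ` M' \<subseteq> path_edges q"
      "path_edges q \<subseteq> (\<lambda>(a, b). {a, b}) ` M' \<union> {{i, Suc i} | i. a \<le> i \<and> i < b - 1}"
      using IH[OF le] by auto
    have ne: "[b..<Suc hi] \<noteq> []" using abl by auto
    have "hd [b..<Suc hi] = b" "last [b..<Suc hi] = hi"
      using abl by (simp_all add: hd_upt del: upt_Suc)
    then have hl: "last (rev [b..<Suc hi]) = b" "hd (rev [b..<Suc hi]) = hi"
      by (simp_all only: last_rev hd_rev)
    have e: "path_edges (rev [b..<Suc hi] @ q) = path_edges [b..<Suc hi] \<union> insert {a, b} (path_edges q)"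
      using ne q hl by (subst path_edges_append) (auto simp: path_edges_rev insert_commute simp del: upt_Suc)
    have u: "path_edges [b..<Suc hi] \<subseteq> {{i, Suc i} | i. lo \<le> i \<and> i < hi}"
      using path_edges_upt[of b "Suc hi"] abl by fastforce
    have u': "{{i, Suc i} | i. a \<le> i \<and> i < b - 1} \<subseteq> {{i, Suc i} | i. lo \<le> i \<and> i < hi}"
      using abl by fastforce
    show ?thesis
    proof (intro exI[of _ "rev [b..<Suc hi] @ q"] conjI)
      show "hd (rev [b..<Suc hi] @ q) = x" using ne x hl by (simp del: upt_Suc)
      have "i < b" if "i \<in> set q" for i using q(4) abl that by force
      then show "distinct (rev [b..<Suc hi] @ q)" using q(3) by (fastforce simp del: upt_Suc)
      have "{a..b - 1} \<subseteq> {lo..hi}" "set (rev [b..<Suc hi]) \<subseteq> {lo..hi}" using abl by auto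
      then show "set (rev [b..<Suc hi] @ q) \<subseteq> {lo..hi}" using q(4) by (simp only: set_append Un_subset_iff) blast
      show "(\<lambda>(a, b). {a, b}) ` M \<subseteq> path_edges (rev [b..<Suc hi] @ q)"
        unfolding e M using q(5) by auto
      show "path_edges (rev [b..<Suc hi] @ q)
          \<subseteq> (\<lambda>(a, b). {a, b}) ` M \<union> {{i, Suc i} | i. lo \<le> i \<and> i < hi}"
        unfolding e M image_insert prod.case by (rule widen[OF u q(6) u'])
    qed (use q in auto)
  qed
qed

text \<open>The zigzag is built on positions and then mapped to vertices by \<open>(!) vs\<close>,
  which is injective on positions; steps between consecutive positions become edges of
  \<open>vs\<close>.\<close>

lemma path_through_nested_chords:
  fixes vs :: "'a list"
  assumes "distinct vs" "vs \<noteq> []" "nested M" "\<forall>(a, b)\<in>M. a < b \<and> b < length vs"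
  obtains us where "us \<noteq> []" "distinct us"
    "(\<lambda>(a, b). {vs ! a, vs ! b}) ` M \<subseteq> path_edges us"
    "path_edges us \<subseteq> (\<lambda>(a, b). {vs ! a, vs ! b}) ` M \<union> path_edges vs"
proof -
  have "M \<subseteq> {..<length vs} \<times> {..<length vs}" using assms(4) by fastforce
  then have "finite M" by (rule finite_subset) auto
  then obtain q where q: "q \<noteq> []" "distinct q" "set q \<subseteq> {0..length vs - 1}"
    "(\<lambda>(a, b). {a, b}) ` M \<subseteq> path_edges q"
    "path_edges q \<subseteq> (\<lambda>(a, b). {a, b}) ` M \<union> {{i, Suc i} | i. 0 \<le> i \<and> i < length vs - 1}"
    using zigzag[of M 0 "length vs - 1" 0] assms by fastforce
  have lt: "i < length vs" if "i \<in> set q" for i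
    using q(3) that assms(2) by (cases vs) auto
  have img: "(\<lambda>(a, b). {vs ! a, vs ! b}) ` M = image ((!) vs) ` (\<lambda>(a, b). {a, b}) ` M"
    by (force simp: image_image)
  have path: "image ((!) vs) ` {{i, Suc i} | i. 0 \<le> i \<and> i < length vs - 1} \<subseteq> path_edges vs"
    unfolding path_edges_conv_nth by fastforce
  show ?thesis
  proof (rule that)
    show "map ((!) vs) q \<noteq> []" using q by simp
    show "distinct (map ((!) vs) q)"
      using q assms(1) lt by (auto simp: distinct_map inj_on_def nth_eq_iff_index_eq)
    show "(\<lambda>(a, b). {vs ! a, vs ! b}) ` M \<subseteq> path_edges (map ((!) vs) q)"
      unfolding path_edges_map img using q(4) by (rule image_mono)
    show "path_edges (map ((!) vs) q) \<subseteq> (\<lambda>(a, b). {vs ! a, vs ! b}) ` M \<union> path_edges vs"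
      unfolding path_edges_map img using image_mono[OF q(5), of "image ((!) vs)"] path
      by (simp only: image_Un) blast
  qed
qed

section \<open>Separating the edges inside a vertex set of a path\<close>

text \<open>Each edge is placed in one class for \<open>c = 1\<close> and one for
  \<open>c = 2\<close>, and each class lies on one zigzag. A zigzag may also run along arbitrary
  edges of \<open>vs\<close>, so its membership reveals the class only for edges off
  \<open>vs\<close>; hence separation is claimed for those alone, but covering for all of
  \<open>H\<close>.\<close>

lemma separate_chords:
  fixes vs :: "'a list"
  assumes vs: "distinct vs" "vs \<noteq> []" and T: "T \<subseteq> set vs"
    and H: "\<And>e. e \<in> H \<Longrightarrow> e \<subseteq> T \<and> card e = 2"
  obtains \<Q> where "finite \<Q>" "card \<Q> \<le> 5 * card T"
    "\<And>Q. Q \<in> \<Q> \<Longrightarrow> \<exists>us. us \<noteq> [] \<and> distinct us \<and> Q = path_edges us \<and> Q \<subseteq> H \<union> path_edges vs"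
    "\<And>e. e \<in> H \<Longrightarrow> \<exists>Q\<in>\<Q>. e \<in> Q"
    "\<And>e f. e \<in> H - path_edges vs \<Longrightarrow> f \<in> H - path_edges vs \<Longrightarrow> e \<noteq> f
      \<Longrightarrow> \<exists>Q\<in>\<Q>. (e \<in> Q) \<noteq> (f \<in> Q)"
proof -
  define I where "I = {i. i < length vs \<and> vs ! i \<in> T}"
  \<comment> \<open>The rank of a position among those in \<open>T\<close>. Ranks instead of
    positions bound the number of classes by \<open>card T\<close> rather than by
    \<open>length vs\<close>.\<close>
  define r where "r i = card {j \<in> I. j < i}" for i
  have finI: "finite I" by (simp add: I_def)
  have "inj_on ((!) vs) I" using vs by (auto simp: I_def inj_on_def nth_eq_iff_index_eq)
  moreover have "(!) vs ` I = T" using T by (force simp: I_def in_set_conv_nth)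
  ultimately have cardI: "card I = card T" using card_image by metis
  have r_less: "r i < r j" if "i \<in> I" "i < j" for i j
    unfolding r_def using that finI by (intro psubset_card_mono) auto
  have r_eq: "i = j" if "i \<in> I" "j \<in> I" "r i = r j" for i j
    using r_less[of i j] r_less[of j i] that by (metis linorder_neqE_nat less_irrefl)
  have r_lt: "r i < card T" if "i \<in> I" for i
    unfolding r_def cardI[symmetric] using that finI by (intro psubset_card_mono) auto
  define M where "M c k = {(a, b). a \<in> I \<and> b \<in> I \<and> a < b \<and> {vs ! a, vs ! b} \<in> H \<and> r a + c * r b = k}"
    for c k
  \<comment> \<open>Moving the left end forward raises its rank, so an equal sum forces the right
    end back. With equal left ends, \<open>c > 0\<close> lets the right ranks be cancelled.\<close>
  have nested: "nested (M c k)" if "c > 0" for c k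
  proof -
    have "(a, b) = (a', b') \<or> a < a' \<and> b' < b \<or> a' < a \<and> b < b'"
      if m: "(a, b) \<in> M c k" "(a', b') \<in> M c k" for a b a' b'
    proof -
      have I: "a \<in> I" "b \<in> I" "a' \<in> I" "b' \<in> I" and eq: "r a + c * r b = r a' + c * r b'"
        using m by (auto simp: M_def)
      have gt: "b > b'" if "r a < r a'" "r a + c * r b = r a' + c * r b'" "b \<in> I" for a a' b b'
      proof (rule ccontr)
        assume "\<not> b > b'"
        then have "r b \<le> r b'" using r_less[of b b'] that(3) by (cases "b = b'") auto
        then have "c * r b \<le> c * r b'" by simp
        then show False using that by linarith
      qed
      consider "a = a'" | "a < a'" | "a' < a" by linarith
      then show ?thesis
      proof cases
        case 1
        then have "r b = r b'" using eq \<open>c > 0\<close> by simp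
        then show ?thesis using 1 r_eq I by simp
      next
        case 2
        then show ?thesis using gt[of a a' b b'] r_less I eq by simp
      next
        case 3
        then show ?thesis using gt[of a' a b' b] r_less I eq by simp
      qed
    qed
    then show ?thesis unfolding nested_def by fast
  qed
  define good where "good c k us \<longleftrightarrow> us \<noteq> [] \<and> distinct us
    \<and> (\<lambda>(a, b). {vs ! a, vs ! b}) ` M c k \<subseteq> path_edges us
    \<and> path_edges us \<subseteq> (\<lambda>(a, b). {vs ! a, vs ! b}) ` M c k \<union> path_edges vs" for c k us
  define q where "q c k = (SOME us. good c k us)" for c k
  have "good c k (q c k)" if "c > 0" for c k
  proof -
    have "\<forall>(a, b)\<in>M c k. a < b \<and> b < length vs" by (auto simp: M_def I_def)
    then have "\<exists>us. good c k us"
    proof (rule path_through_nested_chords[OF vs nested[OF that]])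
      fix us assume "us \<noteq> []" "distinct us" "(\<lambda>(a, b). {vs ! a, vs ! b}) ` M c k \<subseteq> path_edges us"
        "path_edges us \<subseteq> (\<lambda>(a, b). {vs ! a, vs ! b}) ` M c k \<union> path_edges vs"
      then show "\<exists>us. good c k us" unfolding good_def by (intro exI[of _ us] conjI)
    qed
    then show ?thesis unfolding q_def by (rule someI_ex)
  qed
  then have q: "q c k \<noteq> []" "distinct (q c k)"
    "(\<lambda>(a, b). {vs ! a, vs ! b}) ` M c k \<subseteq> path_edges (q c k)"
    "path_edges (q c k) \<subseteq> (\<lambda>(a, b). {vs ! a, vs ! b}) ` M c k \<union> path_edges vs" if "c > 0" for c k
    using that unfolding good_def by auto
  \<comment> \<open>Ranks are below \<open>card T\<close>, so the sums with \<open>c = 1\<close> and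
    \<open>c = 2\<close> stay below \<open>2 * card T\<close> and \<open>3 * card T\<close>.\<close>
  define \<Q> where "\<Q> = (\<lambda>k. path_edges (q 1 k)) ` {..<2 * card T}
    \<union> (\<lambda>k. path_edges (q 2 k)) ` {..<3 * card T}"
  have chord: "\<exists>a b. a \<in> I \<and> b \<in> I \<and> a < b \<and> e = {vs ! a, vs ! b}" if e: "e \<in> H" for e
  proof -
    obtain x y where xy: "e = {x, y}" "x \<noteq> y" using H[OF e] by (auto simp: card_2_iff)
    then have "x \<in> T" "y \<in> T" using H[OF e] by auto
    then obtain a b where "a \<in> I" "b \<in> I" "x = vs ! a" "y = vs ! b"
      using \<open>(!) vs ` I = T\<close> by blast
    then show ?thesis using xy by (metis insert_commute linorder_neqE_nat)
  qed
  \<comment> \<open>Off \<open>vs\<close> a zigzag contains only chords of its own class, and a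
    chord determines its ordered pair of positions because \<open>vs\<close> is distinct.\<close>
  have iff: "{vs ! a, vs ! b} \<in> path_edges (q c k) \<longleftrightarrow> r a + c * r b = k"
    if "c > 0" "a \<in> I" "b \<in> I" "a < b" "{vs ! a, vs ! b} \<in> H - path_edges vs" for a b c k
  proof
    assume "r a + c * r b = k"
    then have "(a, b) \<in> M c k" using that by (auto simp: M_def)
    then show "{vs ! a, vs ! b} \<in> path_edges (q c k)" using q(3)[OF that(1)] by fastforce
  next
    assume "{vs ! a, vs ! b} \<in> path_edges (q c k)"
    then have "{vs ! a, vs ! b} \<in> (\<lambda>(a, b). {vs ! a, vs ! b}) ` M c k"
      using q(4)[OF that(1)] that(5) by blast
    then obtain a' b' where m: "(a', b') \<in> M c k" "{vs ! a, vs ! b} = {vs ! a', vs ! b'}" by auto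
    then have "a' < b'" "a' \<in> I" "b' \<in> I" by (auto simp: M_def)
    then have "a = a' \<and> b = b'"
      using m(2) that vs(1) by (auto simp: doubleton_eq_iff I_def nth_eq_iff_index_eq)
    then show "r a + c * r b = k" using m by (auto simp: M_def)
  qed
  have in1: "path_edges (q 1 (r a + 1 * r b)) \<in> \<Q>" and in2: "path_edges (q 2 (r a + 2 * r b)) \<in> \<Q>"
    if "a \<in> I" "b \<in> I" for a b
    using r_lt[OF that(1)] r_lt[OF that(2)] unfolding \<Q>_def by auto
  show ?thesis
  proof (rule that)
    show "finite \<Q>" by (simp add: \<Q>_def)
    have "card \<Q> \<le> card ((\<lambda>k. path_edges (q 1 k)) ` {..<2 * card T})
        + card ((\<lambda>k. path_edges (q 2 k)) ` {..<3 * card T})"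
      unfolding \<Q>_def by (rule card_Un_le)
    also have "\<dots> \<le> 2 * card T + 3 * card T"
      by (intro add_mono order_trans[OF card_image_le]) auto
    finally show "card \<Q> \<le> 5 * card T" by simp
  next
    fix Q assume "Q \<in> \<Q>"
    then obtain c k where c: "c > 0" "Q = path_edges (q c k)"
      unfolding \<Q>_def by (metis (no_types, lifting) UnE imageE zero_less_one zero_less_numeral)
    have "(\<lambda>(a, b). {vs ! a, vs ! b}) ` M c k \<subseteq> H" by (auto simp: M_def)
    then have "Q \<subseteq> H \<union> path_edges vs" unfolding c(2) using q(4)[OF c(1), of k] by blast
    then show "\<exists>us. us \<noteq> [] \<and> distinct us \<and> Q = path_edges us \<and> Q \<subseteq> H \<union> path_edges vs"
      using q(1,2)[OF c(1), of k] c(2) by blast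
  next
    fix e assume e: "e \<in> H"
    obtain a b where ab: "a \<in> I" "b \<in> I" "a < b" "e = {vs ! a, vs ! b}" using chord[OF e] by blast
    then have "(a, b) \<in> M 1 (r a + 1 * r b)" using e by (auto simp: M_def)
    then have "e \<in> path_edges (q 1 (r a + 1 * r b))" using q(3)[of 1] ab(4) by fastforce
    then show "\<exists>Q\<in>\<Q>. e \<in> Q" using in1 ab by blast
  next
    fix e f assume e: "e \<in> H - path_edges vs" and f: "f \<in> H - path_edges vs" and "e \<noteq> f"
    obtain a b where ab: "a \<in> I" "b \<in> I" "a < b" "e = {vs ! a, vs ! b}" using chord e by blast
    obtain a' b' where ab': "a' \<in> I" "b' \<in> I" "a' < b'" "f = {vs ! a', vs ! b'}" using chord f by blast
    show "\<exists>Q\<in>\<Q>. (e \<in> Q) \<noteq> (f \<in> Q)"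
    \<comment> \<open>Unseparated edges have both sums equal. Subtracting gives equal right ranks,
      then equal left ranks, and rank is injective on \<open>I\<close>.\<close>
    proof (rule ccontr)
      assume same: "\<not> ?thesis"
      have "r a' + 1 * r b' = r a + 1 * r b"
        using same in1[OF ab(1,2)] iff[of 1 a b] iff[of 1 a' b'] ab ab' e f by auto
      moreover have "r a' + 2 * r b' = r a + 2 * r b"
        using same in2[OF ab(1,2)] iff[of 2 a b] iff[of 2 a' b'] ab ab' e f by auto
      ultimately have "r a = r a'" "r b = r b'" by auto
      then show False using r_eq ab ab' \<open>e \<noteq> f\<close> by blast
    qed
  qed
qed

section \<open>Longest paths and the recursion for arbitrary graphs\<close>

lemma longest_path_exists:
  assumes "finite V" "V \<noteq> {}" "\<And>e. e \<in> E \<Longrightarrow> e \<subseteq> V"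
  obtains vs where "vs \<noteq> []" "distinct vs" "set vs \<subseteq> V" "path_edges vs \<subseteq> E"
    "\<And>us. distinct us \<Longrightarrow> path_edges us \<subseteq> E \<Longrightarrow> length us \<le> length vs"
proof -
  define A where "A = {vs. vs \<noteq> [] \<and> distinct vs \<and> set vs \<subseteq> V \<and> path_edges vs \<subseteq> E}"
  obtain v where "v \<in> V" using assms by blast
  then have v: "[v] \<in> A" by (simp add: A_def)
  have "A \<subseteq> {vs. set vs \<subseteq> V \<and> length vs \<le> card V}"
    using assms(1) by (auto simp: A_def) (metis card_mono distinct_card)
  then have "finite A" using finite_lists_length_le[OF assms(1)] finite_subset by blast
  then have fin: "finite (length ` A)" by simp
  then have "Max (length ` A) \<in> length ` A" using v by (intro Max_in) auto
  then obtain vs where "vs \<in> A" "length vs = Max (length ` A)" by auto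
  then have vs: "vs \<in> A" "\<And>us. us \<in> A \<Longrightarrow> length us \<le> length vs"
    using Max_ge[OF fin] by auto
  have "length us \<le> length vs" if us: "distinct us" "path_edges us \<subseteq> E" for us
  \<comment> \<open>A list with at most one vertex has no edges and may lie outside
    \<open>V\<close>, but is no longer than the nonempty \<open>vs\<close>. In a longer list every
    vertex is on an edge and hence in \<open>V\<close>.\<close>
  proof (cases "length us \<le> 1")
    case True
    then show ?thesis using vs(1) by (cases vs) (auto simp: A_def)
  next
    case False
    have "x \<in> V" if "x \<in> set us" for x
    proof -
      obtain i where i: "i < length us" "x = us ! i" using \<open>x \<in> set us\<close> by (auto simp: in_set_conv_nth)
      have "\<exists>e\<in>path_edges us. x \<in> e"
      proof (cases i)
        case 0
        then show ?thesis using i False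
          unfolding path_edges_conv_nth by (intro bexI[of _ "{us ! 0, us ! Suc 0}"]) auto
      next
        case (Suc j)
        then show ?thesis using i
          unfolding path_edges_conv_nth by (intro bexI[of _ "{us ! j, us ! Suc j}"]) auto
      qed
      then show ?thesis using us(2) assms(3) by blast
    qed
    then have "us \<in> A" using us False by (auto simp: A_def)
    then show ?thesis by (rule vs(2))
  qed
  then show ?thesis using that vs(1) by (auto simp: A_def)
qed

text \<open>Induction on the number of vertices, removing the set \<open>S\<close> of rotation ends.
  Covering is part of the claim because the induction step relies on it for the smaller
  graph.\<close>

theorem separating_covering_path_system:
  fixes V :: "nat set"
  assumes "finite V" "\<And>e. e \<in> E \<Longrightarrow> e \<subseteq> V \<and> card e = 2"
  shows "\<exists>\<P>. finite \<P> \<and> card \<P> \<le> 17 * card V \<and> separating_path_system E \<P> \<and> E \<subseteq> \<Union>\<P>"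
  using assms
proof (induction "card V" arbitrary: V E rule: less_induct)
  case less
  show ?case
  proof (cases "V = {}")
    case True
    have "E = {}"
    proof (rule ccontr)
      assume "E \<noteq> {}"
      then obtain e where "e \<in> E" by blast
      then have "e = {}" "card e = 2" using less.prems(2) True by auto
      then show False by simp
    qed
    then show ?thesis by (intro exI[of _ "{}"]) (auto simp: separating_path_system_def)
  next
    case False
    obtain vs where vs: "vs \<noteq> []" "distinct vs" "set vs \<subseteq> V" "path_edges vs \<subseteq> E"
      and longest: "\<And>us. distinct us \<Longrightarrow> path_edges us \<subseteq> E \<Longrightarrow> length us \<le> length vs"
      using longest_path_exists[OF less.prems(1) False, of E] less.prems(2) by blast
    obtain S T where S: "S \<noteq> {}" "S \<subseteq> T" and T: "T \<subseteq> set vs" "card T \<le> 3 * card S"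
      and nbr: "\<And>s w. s \<in> S \<Longrightarrow> {s, w} \<in> E \<Longrightarrow> w \<in> T"
      using posa_rotation[OF vs(2,1,4) longest] by blast
    have SV: "S \<subseteq> V" using S T vs by blast
    then have finS: "finite S" using less.prems(1) finite_subset by blast
    define H where "H = {e \<in> E. e \<inter> S \<noteq> {}}"
    define E' where "E' = {e \<in> E. e \<inter> S = {}}"
    have "card (V - S) < card V" using S SV less.prems(1) by (intro psubset_card_mono) auto
    moreover have "e \<subseteq> V - S \<and> card e = 2" if "e \<in> E'" for e
      using that less.prems(2) by (auto simp: E'_def)
    ultimately obtain \<P> where \<P>: "finite \<P>" "card \<P> \<le> 17 * card (V - S)"
      "separating_path_system E' \<P>" "E' \<subseteq> \<Union>\<P>"
      using less.hyps[of "V - S" E'] less.prems(1) by auto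
    have "e \<subseteq> T \<and> card e = 2" if "e \<in> H" for e
    proof -
      have e: "e \<in> E" "card e = 2" using that less.prems(2) by (auto simp: H_def)
      obtain s where s: "s \<in> e" "s \<in> S" using \<open>e \<in> H\<close> unfolding H_def by blast
      then obtain w where "e = {s, w}" using e by (auto simp: card_2_iff insert_commute)
      then show ?thesis using nbr[of s w] e s S by auto
    qed
    then obtain \<Q> where \<Q>: "finite \<Q>" "card \<Q> \<le> 5 * card T"
      and \<Q>_path: "\<And>Q. Q \<in> \<Q> \<Longrightarrow>
        \<exists>us. us \<noteq> [] \<and> distinct us \<and> Q = path_edges us \<and> Q \<subseteq> H \<union> path_edges vs"
      and \<Q>_cover: "\<And>e. e \<in> H \<Longrightarrow> \<exists>Q\<in>\<Q>. e \<in> Q"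
      and \<Q>_sep: "\<And>e f. e \<in> H - path_edges vs \<Longrightarrow> f \<in> H - path_edges vs \<Longrightarrow> e \<noteq> f
        \<Longrightarrow> \<exists>Q\<in>\<Q>. (e \<in> Q) \<noteq> (f \<in> Q)"
      using separate_chords[OF vs(2,1) T(1), of H] by blast
    \<comment> \<open>Edges of \<open>vs\<close> may occur on many zigzags, so those meeting
      \<open>S\<close> get one-edge paths of their own, which separate them from everything
      else.\<close>
    define \<R> where "\<R> = (\<lambda>e. {e}) ` (H \<inter> path_edges vs)"
    have fin\<R>: "finite \<R>" using finite_path_edges by (auto simp: \<R>_def)
    have "card \<R> \<le> card (H \<inter> path_edges vs)"
      unfolding \<R>_def using finite_path_edges by (intro card_image_le) auto
    also have "H \<inter> path_edges vs \<subseteq> (\<Union>s\<in>S. {e \<in> path_edges vs. s \<in> e})" by (auto simp: H_def)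
    then have "card (H \<inter> path_edges vs) \<le> card (\<Union>s\<in>S. {e \<in> path_edges vs. s \<in> e})"
      using finS by (intro card_mono) (auto simp: finite_path_edges)
    also have "\<dots> \<le> (\<Sum>s\<in>S. card {e \<in> path_edges vs. s \<in> e})" by (rule card_UN_le[OF finS])
    also have "\<dots> \<le> (\<Sum>s\<in>S. 2)" by (intro sum_mono card_path_edges_incident vs)
    finally have card\<R>: "card \<R> \<le> 2 * card S" by simp
    have "is_path_in E' P" if "P \<in> \<P>" for P
      using \<P>(3) that unfolding separating_path_system_def by blast
    moreover have "is_path_in E P \<and> P \<subseteq> E'" if "is_path_in E' P" for P
      using that unfolding is_path_in_def E'_def by auto
    ultimately have path\<P>: "is_path_in E P" and sub: "P \<subseteq> E'" if "P \<in> \<P>" for P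
      using that by blast+
    have path\<Q>: "is_path_in E Q" if "Q \<in> \<Q>" for Q
    proof -
      from \<Q>_path[OF that]
      obtain us where us: "us \<noteq> []" "distinct us" "Q = path_edges us" "Q \<subseteq> H \<union> path_edges vs"
        by blast
      moreover have "H \<union> path_edges vs \<subseteq> E" using vs(4) by (auto simp: H_def)
      ultimately show ?thesis using is_path_in_path_edges[of us E] by blast
    qed
    have path\<R>: "is_path_in E R" if "R \<in> \<R>" for R
    proof -
      from that obtain e where e: "e \<in> H" "R = {e}" by (auto simp: \<R>_def)
      then have "e \<in> E" by (simp add: H_def)
      then obtain x y where "e = {x, y}" "x \<noteq> y" using less.prems(2) by (meson card_2_iff)
      then show ?thesis using is_path_in_path_edges[of "[x, y]" E] e \<open>e \<in> E\<close> by simp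
    qed
    have EH: "E = H \<union> E'" and disj: "H \<inter> E' = {}" by (auto simp: H_def E'_def)
    \<comment> \<open>Covering is used here: some path of the smaller graph contains
      \<open>f\<close>, and it avoids all edges meeting \<open>S\<close>.\<close>
    have mixed: "\<exists>P\<in>\<P>. e \<notin> P \<and> f \<in> P" if "e \<in> H" "f \<in> E'" for e f
    proof -
      obtain P where "P \<in> \<P>" "f \<in> P" using \<P>(4) \<open>f \<in> E'\<close> by blast
      moreover have "e \<notin> P" using sub[OF \<open>P \<in> \<P>\<close>] disj \<open>e \<in> H\<close> by blast
      ultimately show ?thesis by blast
    qed
    have sep: "\<exists>P\<in>\<P> \<union> \<Q> \<union> \<R>. (e \<in> P) \<noteq> (f \<in> P)" if "e \<in> E" "f \<in> E" "e \<noteq> f" for e f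
    proof -
      consider "e \<in> E'" "f \<in> E'" | "e \<in> H" "f \<in> E'" | "e \<in> E'" "f \<in> H"
        | "e \<in> H \<inter> path_edges vs \<or> f \<in> H \<inter> path_edges vs"
        | "e \<in> H - path_edges vs" "f \<in> H - path_edges vs"
        using \<open>e \<in> E\<close> \<open>f \<in> E\<close> EH by blast
      then show ?thesis
      proof cases
        case 1
        then have "\<exists>P\<in>\<P>. (e \<in> P) \<noteq> (f \<in> P)"
          using \<P>(3) that(3) unfolding separating_path_system_def by simp
        then show ?thesis by blast
      next
        case 4
        then have "{e} \<in> \<R> \<or> {f} \<in> \<R>" by (auto simp: \<R>_def)
        moreover have "(e \<in> {e}) \<noteq> (f \<in> {e})" "(e \<in> {f}) \<noteq> (f \<in> {f})" using that(3) by auto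
        ultimately show ?thesis by (meson UnI2)
      next
        case 5
        then show ?thesis using \<Q>_sep[OF _ _ that(3)] by (meson UnI1 UnI2)
      qed (use mixed in \<open>meson UnI1\<close>)+
    qed
    have "card (\<P> \<union> \<Q> \<union> \<R>) \<le> card \<P> + card \<Q> + card \<R>"
      using card_Un_le[of "\<P> \<union> \<Q>" \<R>] card_Un_le[of \<P> \<Q>] by linarith
    \<comment> \<open>The constant is 17 = 5 * 3 + 2: \<Q> has at most \<open>5 * card T\<close>
      members with \<open>card T \<le> 3 * card S\<close>, and \<R> at most
      \<open>2 * card S\<close>.\<close>
    also have "\<dots> \<le> 17 * card (V - S) + 17 * card S"
      using \<P>(2) \<Q>(2) card\<R> T(2) by linarith
    also have "\<dots> = 17 * card V"
      using SV finS card_mono[OF less.prems(1) SV] by (simp add: card_Diff_subset)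
    finally have "card (\<P> \<union> \<Q> \<union> \<R>) \<le> 17 * card V" .
    moreover have "E \<subseteq> \<Union>(\<P> \<union> \<Q> \<union> \<R>)" using EH \<P>(4) \<Q>_cover by blast
    ultimately show ?thesis
      using \<P>(1) \<Q>(1) fin\<R> sep path\<P> path\<Q> path\<R>
      by (intro exI[of _ "\<P> \<union> \<Q> \<union> \<R>"]) (auto simp: separating_path_system_def)
  qed
qed

section \<open>Application to the random graph\<close>

theorem theorem1p4:
  fixes p :: "nat \<Rightarrow> real"
  assumes "\<And>n. 0 \<le> p n \<and> p n \<le> 1"
  shows "(\<lambda>n. measure_pmf.prob (Gnp n (p n))
            {E. \<exists>\<P>. finite \<P> \<and> card \<P> \<le> 48 * n \<and> separating_path_system E \<P>})
         \<longlonglongrightarrow> 1"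
proof -
  \<comment> \<open>Every graph in the support has its edges among the pairs from
    \<open>{..<n}\<close>, so the deterministic bound makes the probability exactly 1 for each
    \<open>n\<close> and the sequence is constant.\<close>
  have "measure_pmf.prob (Gnp n (p n))
      {E. \<exists>\<P>. finite \<P> \<and> card \<P> \<le> 48 * n \<and> separating_path_system E \<P>} = 1" for n
  proof -
    have "\<exists>\<P>. finite \<P> \<and> card \<P> \<le> 48 * n \<and> separating_path_system E \<P>"
      if "E \<in> set_pmf (Gnp n (p n))" for E
    proof -
      have "E \<subseteq> all_pairs n" using that unfolding Gnp_def set_map_pmf by blast
      then have "\<exists>\<P>. finite \<P> \<and> card \<P> \<le> 17 * card {..<n} \<and> separating_path_system E \<P> \<and> E \<subseteq> \<Union>\<P>"
        by (intro separating_covering_path_system) (auto simp: all_pairs_def)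
      then obtain \<P> where "finite \<P>" "card \<P> \<le> 17 * n" "separating_path_system E \<P>" by auto
      then show ?thesis by (intro exI[of _ \<P>]) auto
    qed
    then show ?thesis by (subst measure_pmf.prob_eq_1) (auto simp: AE_measure_pmf_iff)
  qed
  then show ?thesis by simp
qed

end
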